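(* Let $\mathcal{A},\mathcal{B}\in\mathbb{C}^{\mathbf{N}(n)\times\mathbf{N}(n)}$ be such that $\mathcal{A}$, $\mathcal{B}$ and $\mathcal{A}*_n\mathcal{B}$ are core tensors, and suppose $\mathscr{R}(\mathcal{A}^**_n\mathcal{B})=\mathscr{R}(\mathcal{B}*_n\mathcal{A}^* )$. Then $(\mathcal{A}*_n\mathcal{B})^{\mathrm{core}}=\mathcal{B}^{\mathrm{core}}*_n\mathcal{A}^{\mathrm{core}}$ if and only if both of the following hold: (a) $\mathscr{R}(\mathcal{B}^{\mathrm{core}}*_n\mathcal{A})\subseteq\mathscr{R}(\mathcal{A}*_n\mathcal{B})\subseteq\mathscr{R}(\mathcal{B}*_n\mathcal{A})$; (b) $\mathcal{A}*_n\mathcal{A}^{\mathrm{core}}$ and $\mathcal{B}*_n\mathcal{B}^{\mathrm{core}}$ commute (with respect to $*_n$).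
   Context: Here $\mathbf{N}(n)=N_1\times\cdots\times N_n$ and $\mathbb{C}^{\mathbf{N}(n)\times\mathbf{N}(n)}$ is the set of complex tensors $\mathcal{A}=(a_{i_1\ldots i_n j_1\ldots j_n})$ with $1\le i_k,j_k\le N_k$. The Einstein product is $(\mathcal{A}*_n\mathcal{B})_{i_1\ldots i_n j_1\ldots j_n}=\sum_{k_1,\ldots,k_n}a_{i_1\ldots i_n k_1\ldots k_n}b_{k_1\ldots k_n j_1\ldots j_n}$ (and similarly $\mathcal{A}*_n\mathcal{X}\in\mathbb{C}^{\mathbf{N}(n)}$ for $\mathcal{X}\in\mathbb{C}^{\mathbf{N}(n)}$), powers are taken with respect to $*_n$, and $\mathcal{A}^*$ is the conjugate transpose (swap the first $n$ and last $n$ indices and conjugate). The range is $\mathscr{R}(\mathcal{A})=\{\mathcal{A}*_n\mathcal{X}:\mathcal{X}\in\mathbb{C}^{\mathbf{N}(n)}\}$. The index $\mathrm{ind}(\mathcal{A})$ is the smallest positive integer $k$ with $\mathscr{R}(\mathcal{A}^k)=\mathscr{R}(\mathcal{A}^{k+1})$; $\mathcal{A}$ is a core tensor if $\mathrm{ind}(\mathcal{A})=1$. The core inverse $\mathcal{A}^{\mathrm{core}}$ is the (unique, existing when $\mathcal{A}$ is a core tensor) tensor $\mathcal{X}$ with $(\mathcal{A}*_n\mathcal{X})^*=\mathcal{A}*_n\mathcal{X}$, $\mathcal{X}*_n\mathcal{A}^2=\mathcal{A}$, $\mathcal{A}*_n\mathcal{X}^2=\mathcal{X}$. *)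

theory Defs
  imports Complex_Main
begin

(* The dimensions N_1,...,N_n are a list N with n = length N; a multi-index
   (i_1,...,i_n) is a list of length n.  Zero dimensions and n = 0 are not excluded. *)
definition mindex :: "nat list \<Rightarrow> nat list set" where
  "mindex N = {i. length i = length N \<and> (\<forall>k < length N. 1 \<le> i ! k \<and> i ! k \<le> N ! k)}"

(* The two halves (i_1,...,i_n) and (j_1,...,j_n) of the 2n indices are separate arguments. *)
type_synonym tensor = "nat list \<Rightarrow> nat list \<Rightarrow> complex"

(* Entries outside the index range are 0, so that equality of tensors is equality
   of functions, and the products below need no guard on the free indices. *)
definition tensors :: "nat list \<Rightarrow> tensor set" where
  "tensors N = {A. \<forall>i j. i \<notin> mindex N \<or> j \<notin> mindex N \<longrightarrow> A i j = 0}"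

(* The space of order-n tensors with entries x_{i_1...i_n}. *)
definition half_tensors :: "nat list \<Rightarrow> (nat list \<Rightarrow> complex) set" where
  "half_tensors N = {X. \<forall>i. i \<notin> mindex N \<longrightarrow> X i = 0}"

definition einstein_prod :: "tensor \<Rightarrow> nat list \<Rightarrow> tensor \<Rightarrow> tensor"
    ("(_ \<star>\<^bsub>_\<^esub> _)" [70, 0, 71] 70) where
  "A \<star>\<^bsub>N\<^esub> B = (\<lambda>i j. \<Sum>k\<in>mindex N. A i k * B k j)"

definition einstein_app :: "nat list \<Rightarrow> tensor \<Rightarrow> (nat list \<Rightarrow> complex) \<Rightarrow> (nat list \<Rightarrow> complex)" where
  "einstein_app N A X = (\<lambda>i. \<Sum>k\<in>mindex N. A i k * X k)"

definition id_tensor :: "nat list \<Rightarrow> tensor" where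
  "id_tensor N = (\<lambda>i j. if i \<in> mindex N \<and> i = j then 1 else 0)"

primrec tensor_power :: "nat list \<Rightarrow> tensor \<Rightarrow> nat \<Rightarrow> tensor" where
  "tensor_power N A 0 = id_tensor N"
| "tensor_power N A (Suc k) = tensor_power N A k \<star>\<^bsub>N\<^esub> A"

definition ctranspose :: "tensor \<Rightarrow> tensor" where
  "ctranspose A = (\<lambda>i j. cnj (A j i))"

definition tensor_range :: "nat list \<Rightarrow> tensor \<Rightarrow> (nat list \<Rightarrow> complex) set" where
  "tensor_range N A = einstein_app N A ` half_tensors N"

definition tensor_index :: "nat list \<Rightarrow> tensor \<Rightarrow> nat" where
  "tensor_index N A =
    (LEAST k. 0 < k \<and>
       tensor_range N (tensor_power N A k) = tensor_range N (tensor_power N A (k + 1)))"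

definition core_tensor :: "nat list \<Rightarrow> tensor \<Rightarrow> bool" where
  "core_tensor N A \<longleftrightarrow> tensor_index N A = 1"

definition is_core_inverse :: "nat list \<Rightarrow> tensor \<Rightarrow> tensor \<Rightarrow> bool" where
  "is_core_inverse N A X \<longleftrightarrow>
     X \<in> tensors N \<and>
     ctranspose (A \<star>\<^bsub>N\<^esub> X) = A \<star>\<^bsub>N\<^esub> X \<and>
     X \<star>\<^bsub>N\<^esub> tensor_power N A 2 = A \<and>
     A \<star>\<^bsub>N\<^esub> tensor_power N X 2 = X"

(* Unspecified unless the core inverse exists, which it does exactly for core tensors. *)
definition core_inverse :: "nat list \<Rightarrow> tensor \<Rightarrow> tensor" where
  "core_inverse N A = (THE X. is_core_inverse N A X)"

end

theory Submission
  imports Defs "HOL-Library.Function_Algebras"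
begin

text \<open>
  Under the Einstein product the tensors over \<open>N\<close> form a finite-dimensional unital algebra with
  the involution \<open>ctranspose\<close>, and an inclusion of ranges \<open>R(A) \<subseteq> R(B)\<close> is a factorisation
  \<open>A = B Z\<close> (\<open>tensor_range_subset_iff\<close>).  Everything is argued in this algebra.  The
  dimension enters only through \<open>tensor_strongly_pi_regular\<close>: since the powers of \<open>A\<close> are
  linearly dependent, \<open>A^m = A^(m+1) Q = Q A^(m+1)\<close> for some \<open>m\<close> and \<open>Q\<close>.  Applied to
  \<open>A* A\<close> this yields \<open>Y\<close> with \<open>A Y A = A\<close> and \<open>A Y\<close> hermitian; applied to a core tensor
  \<open>A = A A Z\<close> it also yields \<open>A = U A A\<close>, and then \<open>A Z Y\<close> is a core inverse of \<open>A\<close>.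

  Write \<open>X\<close>, \<open>Y\<close> for the core inverses of \<open>A\<close>, \<open>B\<close>, put \<open>C = A B\<close>, and let \<open>P_A = A X\<close> and
  \<open>P_B = B Y\<close> be the orthogonal projections onto \<open>R(A)\<close> and \<open>R(B)\<close>.

  If \<open>Y X\<close> is the core inverse of \<open>C\<close>, then \<open>S = R(C) = R(Y X) = Y R(A)\<close> lies in \<open>R(A)\<close> and
  in \<open>R(B)\<close>, and \<open>B S = P_B R(A)\<close> contains \<open>S\<close>.  Finite dimension forces \<open>B S = S\<close>
  (\<open>range_inverse_invariant\<close>).  Thus \<open>P_B R(A) = S \<subseteq> R(A)\<close>, so the two projections commute,
  and \<open>S = B S \<subseteq> R(B A)\<close>.

  Conversely, the inclusion \<open>R(A* B) \<subseteq> R(B A*)\<close> says that \<open>A\<close> maps the orthogonal complement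
  of \<open>R(B)\<close> into itself, that is, \<open>P_B A P_B = P_B A\<close>; the inclusion \<open>R(C) \<subseteq> R(B A)\<close> gives
  \<open>P_B A P_B = A P_B\<close>.  Hence \<open>A\<close> commutes with \<open>P_B\<close>, and \<open>C Y X = A P_B X = P_B P_A\<close> is
  hermitian because the projections commute.  The other two equations follow from
  \<open>R(Y X) = R(Y A) \<subseteq> R(C)\<close>.
\<close>

section \<open>The algebra of tensors\<close>

lemma finite_mindex [simp]: "finite (mindex N)"
proof (rule finite_subset)
  show "mindex N \<subseteq> {i. set i \<subseteq> {..Max (insert 0 (set N))} \<and> length i = length N}"
    unfolding mindex_def by (auto simp: in_set_conv_nth intro!: Max_ge_iff[THEN iffD2]) (metis nth_mem)
qed (rule finite_lists_length_eq, simp)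

lemma einstein_prod_assoc: "(A \<star>\<^bsub>N\<^esub> B) \<star>\<^bsub>N\<^esub> C = A \<star>\<^bsub>N\<^esub> (B \<star>\<^bsub>N\<^esub> C)"
proof (intro ext)
  fix i j
  have "(\<Sum>k\<in>mindex N. (\<Sum>l\<in>mindex N. A i l * B l k) * C k j) =
        (\<Sum>k\<in>mindex N. \<Sum>l\<in>mindex N. A i l * (B l k * C k j))"
    by (simp add: sum_distrib_right mult.assoc)
  also have "\<dots> = (\<Sum>l\<in>mindex N. \<Sum>k\<in>mindex N. A i l * (B l k * C k j))"
    by (rule sum.swap)
  finally show "((A \<star>\<^bsub>N\<^esub> B) \<star>\<^bsub>N\<^esub> C) i j = (A \<star>\<^bsub>N\<^esub> (B \<star>\<^bsub>N\<^esub> C)) i j"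
    by (simp add: einstein_prod_def sum_distrib_left)
qed

lemma einstein_app_prod:
  "einstein_app N (A \<star>\<^bsub>N\<^esub> B) X = einstein_app N A (einstein_app N B X)"
proof (intro ext)
  fix i
  have "(\<Sum>k\<in>mindex N. (\<Sum>l\<in>mindex N. A i l * B l k) * X k) =
        (\<Sum>k\<in>mindex N. \<Sum>l\<in>mindex N. A i l * (B l k * X k))"
    by (simp add: sum_distrib_right mult.assoc)
  also have "\<dots> = (\<Sum>l\<in>mindex N. \<Sum>k\<in>mindex N. A i l * (B l k * X k))"
    by (rule sum.swap)
  finally show "einstein_app N (A \<star>\<^bsub>N\<^esub> B) X i = einstein_app N A (einstein_app N B X) i"
    by (simp add: einstein_app_def einstein_prod_def sum_distrib_left)
qed

lemma einstein_prod_diff_right: "A \<star>\<^bsub>N\<^esub> (B - C) = A \<star>\<^bsub>N\<^esub> B - A \<star>\<^bsub>N\<^esub> C"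
  by (simp add: einstein_prod_def fun_eq_iff right_diff_distrib sum_subtractf)

lemma ctranspose_prod: "ctranspose (A \<star>\<^bsub>N\<^esub> B) = ctranspose B \<star>\<^bsub>N\<^esub> ctranspose A"
  by (simp add: ctranspose_def einstein_prod_def fun_eq_iff mult.commute)

lemma ctranspose_ctranspose [simp]: "ctranspose (ctranspose A) = A"
  by (simp add: ctranspose_def)

lemma einstein_prod_in_tensors [simp]:
  "A \<in> tensors N \<Longrightarrow> B \<in> tensors N \<Longrightarrow> A \<star>\<^bsub>N\<^esub> B \<in> tensors N"
  by (auto simp: tensors_def einstein_prod_def)

lemma ctranspose_in_tensors [simp]: "A \<in> tensors N \<Longrightarrow> ctranspose A \<in> tensors N"
  by (auto simp: tensors_def ctranspose_def)

lemma id_tensor_in_tensors [simp]: "id_tensor N \<in> tensors N"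
  by (auto simp: tensors_def id_tensor_def)

lemma id_tensor_left [simp]: "A \<in> tensors N \<Longrightarrow> id_tensor N \<star>\<^bsub>N\<^esub> A = A"
proof (intro ext)
  fix i j
  assume "A \<in> tensors N"
  then show "(id_tensor N \<star>\<^bsub>N\<^esub> A) i j = A i j"
    by (cases "i \<in> mindex N")
      (simp_all add: tensors_def id_tensor_def einstein_prod_def if_distrib[of "\<lambda>c. c * _"]
        cong: if_cong)
qed

lemma id_tensor_right [simp]: "A \<in> tensors N \<Longrightarrow> A \<star>\<^bsub>N\<^esub> id_tensor N = A"
  by (auto simp: tensors_def id_tensor_def einstein_prod_def fun_eq_iff if_distrib if_distribR
      cong: if_cong)

lemma tensor_power_in_tensors [simp]: "A \<in> tensors N \<Longrightarrow> tensor_power N A k \<in> tensors N"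
  by (induction k) auto

lemma tensor_power_2: "A \<in> tensors N \<Longrightarrow> tensor_power N A 2 = A \<star>\<^bsub>N\<^esub> A"
  by (simp add: numeral_2_eq_2)

lemma tensor_power_add:
  "A \<in> tensors N \<Longrightarrow>
   tensor_power N A (k + l) = tensor_power N A k \<star>\<^bsub>N\<^esub> tensor_power N A l"
  by (induction l) (simp_all add: einstein_prod_assoc)

lemma tensor_power_commutes:
  "A \<in> tensors N \<Longrightarrow> A \<star>\<^bsub>N\<^esub> tensor_power N A k = tensor_power N A k \<star>\<^bsub>N\<^esub> A"
  using tensor_power_add[of A N 1 k] by simp

text \<open>The forward direction builds \<open>Z\<close> column by column, as each column of \<open>A\<close> lies in the range.\<close>
lemma tensor_range_subset_iff:
  assumes "A \<in> tensors N" "B \<in> tensors N"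
  shows "tensor_range N A \<subseteq> tensor_range N B \<longleftrightarrow> (\<exists>Z\<in>tensors N. A = B \<star>\<^bsub>N\<^esub> Z)"
proof
  assume sub: "tensor_range N A \<subseteq> tensor_range N B"
  have "\<exists>X\<in>half_tensors N. (\<lambda>i. A i j) = einstein_app N B X" if j: "j \<in> mindex N" for j
  proof -
    have "(\<lambda>k. if k = j then 1 else 0) \<in> half_tensors N"
      using j by (auto simp: half_tensors_def)
    moreover have "(\<lambda>i. A i j) = einstein_app N A (\<lambda>k. if k = j then 1 else 0)"
      using j by (simp add: einstein_app_def if_distrib cong: if_cong)
    ultimately have "(\<lambda>i. A i j) \<in> tensor_range N A"
      unfolding tensor_range_def by blast
    with sub show ?thesis
      unfolding tensor_range_def by blast
  qed
  then obtain X where X: "\<And>j. j \<in> mindex N \<Longrightarrow> X j \<in> half_tensors N"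
      "\<And>j. j \<in> mindex N \<Longrightarrow> (\<lambda>i. A i j) = einstein_app N B (X j)"
    by metis
  define Z where "Z = (\<lambda>i j. if j \<in> mindex N then X j i else 0)"
  have "Z \<in> tensors N"
    using X(1) by (auto simp: Z_def tensors_def half_tensors_def)
  moreover have "A = B \<star>\<^bsub>N\<^esub> Z"
  proof (intro ext)
    fix i j
    show "A i j = (B \<star>\<^bsub>N\<^esub> Z) i j"
      using fun_cong[OF X(2), of j i] assms(1)
      by (cases "j \<in> mindex N") (auto simp: Z_def einstein_prod_def einstein_app_def tensors_def)
  qed
  ultimately show "\<exists>Z\<in>tensors N. A = B \<star>\<^bsub>N\<^esub> Z" by blast
next
  assume "\<exists>Z\<in>tensors N. A = B \<star>\<^bsub>N\<^esub> Z"
  then obtain Z where Z: "Z \<in> tensors N" "A = B \<star>\<^bsub>N\<^esub> Z" by blast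
  have "einstein_app N Z X \<in> half_tensors N" for X
    using Z(1) by (auto simp: half_tensors_def tensors_def einstein_app_def)
  then show "tensor_range N A \<subseteq> tensor_range N B"
    by (auto simp: tensor_range_def Z(2) einstein_app_prod)
qed

section \<open>Linear dependence of the powers of a tensor\<close>

lemma sum_tensor_apply: "(\<Sum>k\<in>K. f k) i j = (\<Sum>k\<in>K. f k i j)" for f :: "_ \<Rightarrow> tensor"
  by (induction K rule: infinite_finite_induct) auto

text \<open>
  The powers up to \<open>K\<close> lie in the span of the \<open>K\<close> matrix units; either they are linearly dependent
  or two of them coincide.
\<close>
lemma tensor_powers_dependent:
  assumes A: "A \<in> tensors N"
  shows "\<exists>K w. (\<exists>k\<le>K. w k \<noteq> 0) \<and> (\<forall>i j. (\<Sum>k\<le>K. w k * tensor_power N A k i j) = 0)"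
proof -
  interpret vector_space "\<lambda>c (A :: tensor) i j. c * A i j"
    by unfold_locales (auto simp: fun_eq_iff algebra_simps)
  define unit :: "nat list \<times> nat list \<Rightarrow> tensor"
    where "unit = (\<lambda>(p, q) i j. if i = p \<and> j = q then 1 else 0)"
  define E where "E = unit ` (mindex N \<times> mindex N)"
  have "finite E" by (simp add: E_def)
  have span: "X \<in> span E" if X: "X \<in> tensors N" for X
  proof -
    have "X = (\<Sum>p\<in>mindex N \<times> mindex N. (\<lambda>i j. X (fst p) (snd p) * unit p i j))"
    proof (intro ext)
      fix i j
      have "(\<Sum>p\<in>mindex N \<times> mindex N. X (fst p) (snd p) * unit p i j) =
          (\<Sum>p\<in>mindex N \<times> mindex N. if p = (i, j) then X i j else 0)"
        by (rule sum.cong) (auto simp: unit_def split: if_splits)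
      then show "X i j = (\<Sum>p\<in>mindex N \<times> mindex N. (\<lambda>i j. X (fst p) (snd p) * unit p i j)) i j"
        using X by (auto simp: sum_tensor_apply sum.delta tensors_def)
    qed
    also have "\<dots> \<in> span E"
      by (intro span_sum span_scale span_base) (simp add: E_def)
    finally show ?thesis .
  qed
  define K where "K = card E"
  let ?P = "tensor_power N A"
  show ?thesis
  proof (cases "inj_on ?P {..K}")
    case True
    have "?P ` {..K} \<subseteq> span E"
      using span A by auto
    then have "\<not> independent (?P ` {..K})"
      using independent_span_bound[OF \<open>finite E\<close>, of "?P ` {..K}"]
      card_image[OF True] by (auto simp flip: K_def)
    then obtain u where u: "\<exists>v\<in>?P ` {..K}. u v \<noteq> 0"
        "(\<Sum>v\<in>?P ` {..K}. (\<lambda>i j. u v * v i j)) = 0"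
      by (subst (asm) dependent_finite) auto
    have "(\<Sum>k\<le>K. u (?P k) * ?P k i j) = 0" for i j
      using fun_cong[OF fun_cong[OF u(2), of i], of j]
      by (simp add: sum_tensor_apply sum.reindex[OF True])
    with u(1) show ?thesis
      by (intro exI[of _ K] exI[of _ "\<lambda>k. u (?P k)"]) auto
  next
    case False
    then obtain k l where kl: "k \<le> K" "l \<le> K" "k \<noteq> l" "?P k = ?P l"
      by (auto simp: inj_on_def)
    define w where "w = (\<lambda>r. if r = k then 1 else if r = l then -1 else 0 :: complex)"
    have "(\<Sum>r\<le>K. w r * ?P r i j) = (\<Sum>r\<in>{k, l}. w r * ?P r i j)" for i j
      by (rule sum.mono_neutral_right) (use kl in \<open>auto simp: w_def\<close>)
    then have "(\<Sum>r\<le>K. w r * ?P r i j) = 0" for i j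
      using kl by (simp add: w_def)
    moreover have "w k \<noteq> 0" by (simp add: w_def)
    ultimately show ?thesis using kl(1) by blast
  qed
qed

text \<open>
  If \<open>m\<close> is the lowest degree with a nonzero coefficient in a linear relation between the powers
  of \<open>A\<close>, the relation solved for \<open>A^m\<close> has the form \<open>A^m = A^(m+1) Q\<close> with \<open>Q\<close> a polynomial in \<open>A\<close>.
\<close>
lemma tensor_strongly_pi_regular:
  assumes A: "A \<in> tensors N"
  obtains m Q where "Q \<in> tensors N"
    "tensor_power N A m = tensor_power N A (Suc m) \<star>\<^bsub>N\<^esub> Q"
    "tensor_power N A m = Q \<star>\<^bsub>N\<^esub> tensor_power N A (Suc m)"
proof -
  let ?P = "tensor_power N A"
  obtain K w where w: "\<exists>k\<le>K. w k \<noteq> 0" "\<And>i j. (\<Sum>k\<le>K. w k * ?P k i j) = 0"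
    using tensor_powers_dependent[OF A] by metis
  define m where "m = (LEAST k. k \<le> K \<and> w k \<noteq> 0)"
  have m: "m \<le> K" "w m \<noteq> 0"
    using LeastI_ex[OF w(1)] by (auto simp: m_def)
  have low: "w k = 0" if "k < m" for k
    using not_less_Least[of k "\<lambda>k. k \<le> K \<and> w k \<noteq> 0"] that m(1) by (auto simp: m_def)
  define Q where "Q = (\<lambda>i j. \<Sum>k\<in>{Suc m..K}. - (w k / w m) * ?P (k - Suc m) i j)"
  have Q_left: "C \<star>\<^bsub>N\<^esub> Q = (\<lambda>i j. \<Sum>k\<in>{Suc m..K}. - (w k / w m) * (C \<star>\<^bsub>N\<^esub> ?P (k - Suc m)) i j)" for C
  proof (intro ext)
    fix i j
    have "(C \<star>\<^bsub>N\<^esub> Q) i j = (\<Sum>l\<in>mindex N. \<Sum>k\<in>{Suc m..K}. - (w k / w m) * (C i l * ?P (k - Suc m) l j))"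
      unfolding einstein_prod_def Q_def sum_distrib_left by (simp add: mult_ac)
    also have "\<dots> = (\<Sum>k\<in>{Suc m..K}. \<Sum>l\<in>mindex N. - (w k / w m) * (C i l * ?P (k - Suc m) l j))"
      by (rule sum.swap)
    finally show "(C \<star>\<^bsub>N\<^esub> Q) i j = (\<Sum>k\<in>{Suc m..K}. - (w k / w m) * (C \<star>\<^bsub>N\<^esub> ?P (k - Suc m)) i j)"
      by (simp only: einstein_prod_def sum_distrib_left)
  qed
  have Q_right: "Q \<star>\<^bsub>N\<^esub> C = (\<lambda>i j. \<Sum>k\<in>{Suc m..K}. - (w k / w m) * (?P (k - Suc m) \<star>\<^bsub>N\<^esub> C) i j)" for C
  proof (intro ext)
    fix i j
    have "(Q \<star>\<^bsub>N\<^esub> C) i j = (\<Sum>l\<in>mindex N. \<Sum>k\<in>{Suc m..K}. - (w k / w m) * (?P (k - Suc m) i l * C l j))"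
      unfolding einstein_prod_def Q_def sum_distrib_right by (simp add: mult_ac)
    also have "\<dots> = (\<Sum>k\<in>{Suc m..K}. \<Sum>l\<in>mindex N. - (w k / w m) * (?P (k - Suc m) i l * C l j))"
      by (rule sum.swap)
    finally show "(Q \<star>\<^bsub>N\<^esub> C) i j = (\<Sum>k\<in>{Suc m..K}. - (w k / w m) * (?P (k - Suc m) \<star>\<^bsub>N\<^esub> C) i j)"
      by (simp only: einstein_prod_def sum_distrib_left)
  qed
  show thesis
  proof
    have "?P k i j = 0" if "i \<notin> mindex N \<or> j \<notin> mindex N" for k i j
      using tensor_power_in_tensors[OF A, of k] that by (auto simp: tensors_def)
    then show "Q \<in> tensors N"
      by (auto simp: tensors_def Q_def)
    have P_m: "?P m i j = (\<Sum>k\<in>{Suc m..K}. - (w k / w m) * ?P k i j)" for i j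
    proof -
      have "0 = (\<Sum>k\<le>K. w k * ?P k i j)" by (simp add: w(2))
      also have "\<dots> = (\<Sum>k\<in>{m..K}. w k * ?P k i j)"
        by (rule sum.mono_neutral_right) (auto simp: low not_le)
      also have "\<dots> = w m * ?P m i j + (\<Sum>k\<in>{Suc m..K}. w k * ?P k i j)"
        using m(1) by (simp add: sum.atLeast_Suc_atMost)
      finally have "?P m i j = - (\<Sum>k\<in>{Suc m..K}. w k * ?P k i j) / w m"
        using m(2) by (simp add: field_simps eq_neg_iff_add_eq_0)
      then show ?thesis
        by (simp add: sum_negf sum_divide_distrib)
    qed
    have "?P k = ?P (Suc m) \<star>\<^bsub>N\<^esub> ?P (k - Suc m)" "?P k = ?P (k - Suc m) \<star>\<^bsub>N\<^esub> ?P (Suc m)"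
      if "k \<in> {Suc m..K}" for k
      using that by (simp_all flip: tensor_power_add[OF A] del: tensor_power.simps)
    with P_m show "?P m = ?P (Suc m) \<star>\<^bsub>N\<^esub> Q" "?P m = Q \<star>\<^bsub>N\<^esub> ?P (Suc m)"
      unfolding Q_left Q_right fun_eq_iff by (metis (no_types, lifting) sum.cong)+
  qed
qed

section \<open>Existence and uniqueness of core inverses\<close>
lemma ctranspose_prod_self_eq_0:
  assumes "ctranspose D \<star>\<^bsub>N\<^esub> D = 0" "D \<in> tensors N"
  shows "D = 0"
proof (intro ext)
  fix i j
  have "(\<Sum>k\<in>mindex N. cnj (D k j) * D k j) = 0"
    using fun_cong[OF fun_cong[OF assms(1), of j], of j]
    by (simp add: einstein_prod_def ctranspose_def)
  then have "(\<Sum>k\<in>mindex N. complex_of_real ((cmod (D k j))\<^sup>2)) = 0"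
    by (simp only: complex_norm_square mult.commute)
  then have "(\<Sum>k\<in>mindex N. (cmod (D k j))\<^sup>2) = 0"
    by (metis (no_types) of_real_sum of_real_eq_0_iff)
  then have "\<forall>k\<in>mindex N. D k j = 0"
    by (subst (asm) sum_nonneg_eq_0_iff) auto
  then show "D i j = 0 i j"
    using assms(2) by (cases "i \<in> mindex N") (auto simp: tensors_def)
qed

lemma tensors_diff: "A \<in> tensors N \<Longrightarrow> B \<in> tensors N \<Longrightarrow> A - B \<in> tensors N"
  by (auto simp: tensors_def)

lemma ctranspose_cancel:
  assumes "A \<in> tensors N" "U \<in> tensors N" "V \<in> tensors N"
    and eq: "ctranspose A \<star>\<^bsub>N\<^esub> (A \<star>\<^bsub>N\<^esub> U) = ctranspose A \<star>\<^bsub>N\<^esub> (A \<star>\<^bsub>N\<^esub> V)"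
  shows "A \<star>\<^bsub>N\<^esub> U = A \<star>\<^bsub>N\<^esub> V"
proof -
  let ?D = "A \<star>\<^bsub>N\<^esub> (U - V)"
  have "ctranspose ?D \<star>\<^bsub>N\<^esub> ?D = ctranspose (U - V) \<star>\<^bsub>N\<^esub> (ctranspose A \<star>\<^bsub>N\<^esub> ?D)"
    by (simp add: ctranspose_prod einstein_prod_assoc)
  also have "ctranspose A \<star>\<^bsub>N\<^esub> ?D = 0"
    by (simp add: einstein_prod_diff_right eq)
  finally have "ctranspose ?D \<star>\<^bsub>N\<^esub> ?D = 0"
    by (simp add: einstein_prod_def fun_eq_iff)
  then have "?D = 0"
    by (rule ctranspose_prod_self_eq_0) (simp add: assms tensors_diff)
  then show ?thesis
    by (simp add: einstein_prod_diff_right)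
qed

lemma hermitian_power_cancel:
  assumes "M \<in> tensors N" "ctranspose M = M" "U \<in> tensors N" "V \<in> tensors N"
  shows "tensor_power N M (Suc m) \<star>\<^bsub>N\<^esub> U = tensor_power N M (Suc m) \<star>\<^bsub>N\<^esub> V \<Longrightarrow> M \<star>\<^bsub>N\<^esub> U = M \<star>\<^bsub>N\<^esub> V"
proof (induction m)
  case (Suc m)
  let ?W = "tensor_power N M m"
  have "M \<star>\<^bsub>N\<^esub> (M \<star>\<^bsub>N\<^esub> (?W \<star>\<^bsub>N\<^esub> X)) = tensor_power N M (Suc (Suc m)) \<star>\<^bsub>N\<^esub> X" for X
    by (metis assms(1) einstein_prod_assoc tensor_power.simps(2) tensor_power_commutes)
  with Suc.prems have "M \<star>\<^bsub>N\<^esub> (M \<star>\<^bsub>N\<^esub> (?W \<star>\<^bsub>N\<^esub> U)) = M \<star>\<^bsub>N\<^esub> (M \<star>\<^bsub>N\<^esub> (?W \<star>\<^bsub>N\<^esub> V))"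
    by simp
  then have "M \<star>\<^bsub>N\<^esub> (?W \<star>\<^bsub>N\<^esub> U) = M \<star>\<^bsub>N\<^esub> (?W \<star>\<^bsub>N\<^esub> V)"
    using ctranspose_cancel[of M N "?W \<star>\<^bsub>N\<^esub> U" "?W \<star>\<^bsub>N\<^esub> V"] assms by simp
  then show ?case
    by (intro Suc.IH) (metis assms(1) einstein_prod_assoc tensor_power.simps(2) tensor_power_commutes)
qed (use assms in simp)

text \<open>
  Strong \<open>\<pi>\<close>-regularity of \<open>M = A* A\<close> and cancellation give \<open>A = A Q A* A\<close>; then
  \<open>Y = Q* A*\<close> works, since \<open>A Y = (A Y)* (A Y)\<close>.
\<close>
lemma hermitian_inner_inverse_exists:
  assumes A: "A \<in> tensors N"
  obtains Y where "Y \<in> tensors N" "A \<star>\<^bsub>N\<^esub> (Y \<star>\<^bsub>N\<^esub> A) = A"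
    "ctranspose (A \<star>\<^bsub>N\<^esub> Y) = A \<star>\<^bsub>N\<^esub> Y"
proof -
  define M where "M = ctranspose A \<star>\<^bsub>N\<^esub> A"
  have M: "M \<in> tensors N" "ctranspose M = M"
    using A by (simp_all add: M_def ctranspose_prod)
  obtain m Q where Q: "Q \<in> tensors N" "tensor_power N M m = tensor_power N M (Suc m) \<star>\<^bsub>N\<^esub> Q"
    using tensor_strongly_pi_regular[OF M(1)] by metis
  have "tensor_power N M (Suc m) \<star>\<^bsub>N\<^esub> id_tensor N = tensor_power N M m \<star>\<^bsub>N\<^esub> M"
    using M by simp
  also have "\<dots> = tensor_power N M (Suc m) \<star>\<^bsub>N\<^esub> (Q \<star>\<^bsub>N\<^esub> M)"
    by (subst Q(2)) (simp only: einstein_prod_assoc)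
  finally have "M \<star>\<^bsub>N\<^esub> id_tensor N = M \<star>\<^bsub>N\<^esub> (Q \<star>\<^bsub>N\<^esub> M)"
    by (rule hermitian_power_cancel[OF M, rotated 2]) (use Q(1) M(1) in simp_all)
  then have AQM: "A = A \<star>\<^bsub>N\<^esub> (Q \<star>\<^bsub>N\<^esub> (ctranspose A \<star>\<^bsub>N\<^esub> A))"
    using ctranspose_cancel[OF A, of "id_tensor N" "Q \<star>\<^bsub>N\<^esub> M"] A M Q(1)
    by (simp add: M_def einstein_prod_assoc)
  define Y where "Y = ctranspose Q \<star>\<^bsub>N\<^esub> ctranspose A"
  have AYA: "A = ctranspose (A \<star>\<^bsub>N\<^esub> Y) \<star>\<^bsub>N\<^esub> A"
    using AQM by (simp add: Y_def ctranspose_prod einstein_prod_assoc)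
  then have "A \<star>\<^bsub>N\<^esub> Y = ctranspose (A \<star>\<^bsub>N\<^esub> Y) \<star>\<^bsub>N\<^esub> (A \<star>\<^bsub>N\<^esub> Y)"
    by (metis einstein_prod_assoc)
  then have herm: "ctranspose (A \<star>\<^bsub>N\<^esub> Y) = A \<star>\<^bsub>N\<^esub> Y"
    by (metis ctranspose_prod ctranspose_ctranspose)
  show thesis
  proof
    show "Y \<in> tensors N" using A Q(1) by (simp add: Y_def)
    show "A \<star>\<^bsub>N\<^esub> (Y \<star>\<^bsub>N\<^esub> A) = A" using AYA herm by (simp add: einstein_prod_assoc)
  qed (rule herm)
qed

text \<open>
  The index is a least number, which only says something if some exponent qualifies.  Strong
  \<open>\<pi>\<close>-regularity provides one.
\<close>
lemma core_tensor_factor_right: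
  assumes A: "A \<in> tensors N" and core: "core_tensor N A"
  obtains Z where "Z \<in> tensors N" "A = A \<star>\<^bsub>N\<^esub> (A \<star>\<^bsub>N\<^esub> Z)"
proof -
  let ?R = "\<lambda>k. 0 < k \<and> tensor_range N (tensor_power N A k) = tensor_range N (tensor_power N A (k + 1))"
  obtain m Q where Q: "Q \<in> tensors N" "tensor_power N A m = tensor_power N A (Suc m) \<star>\<^bsub>N\<^esub> Q"
    using tensor_strongly_pi_regular[OF A] by metis
  have "tensor_power N A (Suc m) = tensor_power N A (Suc (Suc m)) \<star>\<^bsub>N\<^esub> Q"
    using Q(2) by (metis A einstein_prod_assoc tensor_power.simps(2) tensor_power_commutes)
  then have "tensor_range N (tensor_power N A (Suc m)) \<subseteq> tensor_range N (tensor_power N A (Suc (Suc m)))"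
    using tensor_range_subset_iff A Q(1) tensor_power_in_tensors by blast
  moreover have "tensor_range N (tensor_power N A (Suc (Suc m))) \<subseteq> tensor_range N (tensor_power N A (Suc m))"
    using tensor_range_subset_iff A tensor_power_in_tensors tensor_power.simps(2) by blast
  ultimately have "?R (Suc m)" by simp
  then have "?R (LEAST k. ?R k)" by (rule LeastI)
  moreover have "(LEAST k. ?R k) = 1"
    using core unfolding core_tensor_def tensor_index_def .
  ultimately have "?R 1" by metis
  then have "tensor_range N A \<subseteq> tensor_range N (A \<star>\<^bsub>N\<^esub> A)"
    using A by (simp add: einstein_prod_assoc)
  then show thesis
    using that A by (auto simp: tensor_range_subset_iff einstein_prod_assoc)
qed

text \<open>In finite dimension, \<open>R(A) \<subseteq> R(A^2)\<close> implies that \<open>A\<close> and \<open>A^2\<close> have the same kernel.\<close>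
lemma square_factor_left:
  assumes A: "A \<in> tensors N" and Z: "A = A \<star>\<^bsub>N\<^esub> (A \<star>\<^bsub>N\<^esub> Z)"
  obtains U where "A = U \<star>\<^bsub>N\<^esub> (A \<star>\<^bsub>N\<^esub> A)"
proof -
  let ?P = "tensor_power N A"
  obtain m Q where Q: "?P m = Q \<star>\<^bsub>N\<^esub> ?P (Suc m)"
    using tensor_strongly_pi_regular[OF A] by metis
  have "\<exists>W. A = ?P k \<star>\<^bsub>N\<^esub> (A \<star>\<^bsub>N\<^esub> W)" for k
  proof (induction k)
    case 0
    have "A = ?P 0 \<star>\<^bsub>N\<^esub> (A \<star>\<^bsub>N\<^esub> (A \<star>\<^bsub>N\<^esub> Z))"
      using A Z by simp
    then show ?case by blast
  next
    case (Suc k)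
    then obtain W where "A = ?P k \<star>\<^bsub>N\<^esub> (A \<star>\<^bsub>N\<^esub> W)" by blast
    then have "A = ?P (Suc k) \<star>\<^bsub>N\<^esub> (A \<star>\<^bsub>N\<^esub> (Z \<star>\<^bsub>N\<^esub> W))"
      using Z by (metis einstein_prod_assoc tensor_power.simps(2))
    then show ?case by blast
  qed
  then obtain W where W: "A = ?P m \<star>\<^bsub>N\<^esub> (A \<star>\<^bsub>N\<^esub> W)" by blast
  have "A = Q \<star>\<^bsub>N\<^esub> (A \<star>\<^bsub>N\<^esub> (?P m \<star>\<^bsub>N\<^esub> (A \<star>\<^bsub>N\<^esub> W)))"
    using W Q by (metis A einstein_prod_assoc tensor_power.simps(2) tensor_power_commutes)
  then show thesis
    using that W by simp
qed

text \<open>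
  Here \<open>A Z = U A\<close>, so \<open>A Z Z\<close> is the group inverse of \<open>A\<close>, and multiplying it by the projection
  \<open>A Y\<close> gives \<open>A Z Z A Y = A Z Y\<close>.
\<close>
lemma is_core_inverse_exists:
  assumes A: "A \<in> tensors N" and core: "core_tensor N A"
  obtains X where "is_core_inverse N A X"
proof -
  obtain Z where Z: "Z \<in> tensors N" "A = A \<star>\<^bsub>N\<^esub> (A \<star>\<^bsub>N\<^esub> Z)"
    using core_tensor_factor_right[OF A core] .
  obtain U where U: "A = U \<star>\<^bsub>N\<^esub> (A \<star>\<^bsub>N\<^esub> A)"
    using square_factor_left[OF A Z(2)] .
  obtain Y where Y: "Y \<in> tensors N" "A \<star>\<^bsub>N\<^esub> (Y \<star>\<^bsub>N\<^esub> A) = A"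
      "ctranspose (A \<star>\<^bsub>N\<^esub> Y) = A \<star>\<^bsub>N\<^esub> Y"
    using hermitian_inner_inverse_exists[OF A] .
  define X where "X = A \<star>\<^bsub>N\<^esub> (Z \<star>\<^bsub>N\<^esub> Y)"
  have UA: "U \<star>\<^bsub>N\<^esub> A = A \<star>\<^bsub>N\<^esub> Z"
    using U Z(2) by (metis einstein_prod_assoc)
  have AX: "A \<star>\<^bsub>N\<^esub> X = A \<star>\<^bsub>N\<^esub> Y"
    using Z(2) unfolding X_def by (metis einstein_prod_assoc)
  have "X \<star>\<^bsub>N\<^esub> (A \<star>\<^bsub>N\<^esub> A) = U \<star>\<^bsub>N\<^esub> (A \<star>\<^bsub>N\<^esub> (Y \<star>\<^bsub>N\<^esub> A) \<star>\<^bsub>N\<^esub> A)"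
    unfolding X_def using UA by (metis einstein_prod_assoc)
  then have "X \<star>\<^bsub>N\<^esub> (A \<star>\<^bsub>N\<^esub> A) = A"
    using Y(2) U by simp
  moreover have "A \<star>\<^bsub>N\<^esub> (X \<star>\<^bsub>N\<^esub> X) = A \<star>\<^bsub>N\<^esub> (Y \<star>\<^bsub>N\<^esub> A) \<star>\<^bsub>N\<^esub> (Z \<star>\<^bsub>N\<^esub> Y)"
    using AX by (metis X_def einstein_prod_assoc)
  moreover have "X \<in> tensors N"
    using A Z(1) Y(1) by (simp add: X_def)
  ultimately have "is_core_inverse N A X"
    using Y(2,3) AX unfolding is_core_inverse_def by (simp add: tensor_power_2 A X_def)
  then show thesis by (rule that)
qed

lemma is_core_inverse_iff:
  assumes "A \<in> tensors N"
  shows "is_core_inverse N A X \<longleftrightarrow> X \<in> tensors N \<and> ctranspose (A \<star>\<^bsub>N\<^esub> X) = A \<star>\<^bsub>N\<^esub> X \<and>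
     X \<star>\<^bsub>N\<^esub> (A \<star>\<^bsub>N\<^esub> A) = A \<and> A \<star>\<^bsub>N\<^esub> (X \<star>\<^bsub>N\<^esub> X) = X"
  using assms by (auto simp: is_core_inverse_def tensor_power_2)

lemma core_inverse_inner:
  assumes "A \<in> tensors N" "is_core_inverse N A X"
  shows "A \<star>\<^bsub>N\<^esub> (X \<star>\<^bsub>N\<^esub> A) = A"
  using assms(2) unfolding is_core_inverse_iff[OF assms(1)] by (metis einstein_prod_assoc)

lemma core_inverse_outer:
  assumes "A \<in> tensors N" "is_core_inverse N A X"
  shows "X \<star>\<^bsub>N\<^esub> (A \<star>\<^bsub>N\<^esub> X) = X"
  using assms(2) unfolding is_core_inverse_iff[OF assms(1)] by (metis einstein_prod_assoc)

text \<open>Both \<open>A X\<close> and \<open>A Y\<close> are the orthogonal projection onto \<open>R(A)\<close>, so they agree.\<close>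
lemma is_core_inverse_unique:
  assumes A: "A \<in> tensors N" and X: "is_core_inverse N A X" and Y: "is_core_inverse N A Y"
  shows "X = Y"
proof -
  note X' = X[unfolded is_core_inverse_iff[OF A]] and Y' = Y[unfolded is_core_inverse_iff[OF A]]
  have XY: "(A \<star>\<^bsub>N\<^esub> X) \<star>\<^bsub>N\<^esub> (A \<star>\<^bsub>N\<^esub> Y) = A \<star>\<^bsub>N\<^esub> Y"
    using core_inverse_inner[OF A X] by (metis einstein_prod_assoc)
  have YX: "(A \<star>\<^bsub>N\<^esub> Y) \<star>\<^bsub>N\<^esub> (A \<star>\<^bsub>N\<^esub> X) = A \<star>\<^bsub>N\<^esub> X"
    using core_inverse_inner[OF A Y] by (metis einstein_prod_assoc)
  have "A \<star>\<^bsub>N\<^esub> Y = A \<star>\<^bsub>N\<^esub> X"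
    using XY YX X' Y' by (metis ctranspose_prod)
  then have "X = X \<star>\<^bsub>N\<^esub> (A \<star>\<^bsub>N\<^esub> (A \<star>\<^bsub>N\<^esub> (Y \<star>\<^bsub>N\<^esub> Y)))"
    using core_inverse_outer[OF A X] Y' by metis
  also have "\<dots> = Y"
    using X' Y' by (metis einstein_prod_assoc)
  finally show ?thesis .
qed

lemma core_inverse_eq_iff:
  assumes "A \<in> tensors N" "core_tensor N A"
  shows "core_inverse N A = X \<longleftrightarrow> is_core_inverse N A X"
proof -
  obtain X0 where "is_core_inverse N A X0"
    using is_core_inverse_exists[OF assms] .
  then have "\<exists>!X. is_core_inverse N A X"
    using is_core_inverse_unique[OF assms(1)] by blast
  then show ?thesis
    unfolding core_inverse_def by (metis (mono_tags) theI')
qed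

section \<open>The reverse order law\<close>

text \<open>
  If \<open>B\<close> maps \<open>R(C L) \<subseteq> R(C)\<close> onto \<open>R(C)\<close>, then \<open>R(C L)\<close> is all of \<open>R(C)\<close> by dimension, so \<open>B\<close>
  leaves \<open>R(C)\<close> invariant.  In algebraic form: \<open>B^k C L^k = C\<close>, so \<open>C L^k\<close> may be cancelled to
  \<open>C\<close>, which turns \<open>L^m = L^(m+1) Q\<close> into \<open>C = C L Q\<close>.
\<close>
lemma range_inverse_invariant:
  assumes L: "L \<in> tensors N" and C: "C \<in> tensors N" and inv: "B \<star>\<^bsub>N\<^esub> (C \<star>\<^bsub>N\<^esub> L) = C"
  obtains Q where "B \<star>\<^bsub>N\<^esub> C = C \<star>\<^bsub>N\<^esub> Q"
proof -
  let ?P = "tensor_power N L"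
  have cancel: "C \<star>\<^bsub>N\<^esub> (?P k \<star>\<^bsub>N\<^esub> V) = C \<star>\<^bsub>N\<^esub> (?P k \<star>\<^bsub>N\<^esub> W) \<Longrightarrow> C \<star>\<^bsub>N\<^esub> V = C \<star>\<^bsub>N\<^esub> W"
    if "V \<in> tensors N" "W \<in> tensors N" for k V W
  proof (induction k)
    case (Suc k)
    have "B \<star>\<^bsub>N\<^esub> (C \<star>\<^bsub>N\<^esub> (?P (Suc k) \<star>\<^bsub>N\<^esub> D)) = C \<star>\<^bsub>N\<^esub> (?P k \<star>\<^bsub>N\<^esub> D)" for D
      using inv by (metis L einstein_prod_assoc tensor_power.simps(2) tensor_power_commutes)
    with Suc show ?case by metis
  qed (use that in simp)
  obtain m Q where Q: "Q \<in> tensors N" "?P m = ?P (Suc m) \<star>\<^bsub>N\<^esub> Q"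
    using tensor_strongly_pi_regular[OF L] by metis
  have "C \<star>\<^bsub>N\<^esub> (?P m \<star>\<^bsub>N\<^esub> id_tensor N) = C \<star>\<^bsub>N\<^esub> (?P m \<star>\<^bsub>N\<^esub> (L \<star>\<^bsub>N\<^esub> Q))"
    using Q(2) L by (metis id_tensor_right einstein_prod_assoc tensor_power.simps(2) tensor_power_in_tensors)
  then have "C \<star>\<^bsub>N\<^esub> id_tensor N = C \<star>\<^bsub>N\<^esub> (L \<star>\<^bsub>N\<^esub> Q)"
    by (rule cancel[rotated 2]) (use L Q in simp_all)
  then have "B \<star>\<^bsub>N\<^esub> C = C \<star>\<^bsub>N\<^esub> Q"
    using inv C by (metis id_tensor_right einstein_prod_assoc)
  then show thesis by (rule that)
qed

text \<open>
  With \<open>C = A B\<close> and \<open>Y A = C F\<close>, the equation \<open>B C (F B) = C\<close> says that \<open>B\<close> maps a subspace of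
  \<open>R(C)\<close> onto \<open>R(C)\<close>, so that \<open>R(C)\<close> is invariant under \<open>B\<close>.
\<close>
lemma reverse_order_law_necessary:
  assumes A: "A \<in> tensors N" and B: "B \<in> tensors N"
    and X: "is_core_inverse N A X" and Y: "is_core_inverse N B Y"
    and YX: "is_core_inverse N (A \<star>\<^bsub>N\<^esub> B) (Y \<star>\<^bsub>N\<^esub> X)"
  shows "\<exists>K\<in>tensors N. Y \<star>\<^bsub>N\<^esub> A = (A \<star>\<^bsub>N\<^esub> B) \<star>\<^bsub>N\<^esub> K"
    and "\<exists>K\<in>tensors N. A \<star>\<^bsub>N\<^esub> B = (B \<star>\<^bsub>N\<^esub> A) \<star>\<^bsub>N\<^esub> K"
    and "(A \<star>\<^bsub>N\<^esub> X) \<star>\<^bsub>N\<^esub> (B \<star>\<^bsub>N\<^esub> Y) = (B \<star>\<^bsub>N\<^esub> Y) \<star>\<^bsub>N\<^esub> (A \<star>\<^bsub>N\<^esub> X)"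
proof -
  note X' = X[unfolded is_core_inverse_iff[OF A]] and Y' = Y[unfolded is_core_inverse_iff[OF B]]
  define C where "C = A \<star>\<^bsub>N\<^esub> B"
  have C: "C \<in> tensors N" using A B by (simp add: C_def)
  note C' = YX[folded C_def, unfolded is_core_inverse_iff[OF C]]
  define F where "F = (Y \<star>\<^bsub>N\<^esub> X) \<star>\<^bsub>N\<^esub> ((Y \<star>\<^bsub>N\<^esub> X) \<star>\<^bsub>N\<^esub> (A \<star>\<^bsub>N\<^esub> A))"
  have F: "F \<in> tensors N" using A X' Y' by (simp add: F_def)
  have YA: "Y \<star>\<^bsub>N\<^esub> A = C \<star>\<^bsub>N\<^esub> F"
    unfolding F_def using X' C' by (metis einstein_prod_assoc)
  then show "\<exists>K\<in>tensors N. Y \<star>\<^bsub>N\<^esub> A = (A \<star>\<^bsub>N\<^esub> B) \<star>\<^bsub>N\<^esub> K"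
    using F unfolding C_def by blast
  have "B \<star>\<^bsub>N\<^esub> (Y \<star>\<^bsub>N\<^esub> Y) = Y" using Y' by simp
  then have "B \<star>\<^bsub>N\<^esub> (Y \<star>\<^bsub>N\<^esub> (Y \<star>\<^bsub>N\<^esub> X)) = Y \<star>\<^bsub>N\<^esub> X"
    by (metis einstein_prod_assoc)
  then have C_fixed: "B \<star>\<^bsub>N\<^esub> (Y \<star>\<^bsub>N\<^esub> C) = C"
    using C' core_inverse_inner[OF B Y] by (metis einstein_prod_assoc)
  have BCFB: "B \<star>\<^bsub>N\<^esub> (C \<star>\<^bsub>N\<^esub> (F \<star>\<^bsub>N\<^esub> B)) = C"
    using C_fixed YA by (metis C_def einstein_prod_assoc)
  have "C = (B \<star>\<^bsub>N\<^esub> A) \<star>\<^bsub>N\<^esub> (B \<star>\<^bsub>N\<^esub> (F \<star>\<^bsub>N\<^esub> B))"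
    using BCFB by (simp add: C_def einstein_prod_assoc)
  then show "\<exists>K\<in>tensors N. A \<star>\<^bsub>N\<^esub> B = (B \<star>\<^bsub>N\<^esub> A) \<star>\<^bsub>N\<^esub> K"
    using B F C_def by (metis einstein_prod_in_tensors)
  obtain Q where Q: "B \<star>\<^bsub>N\<^esub> C = C \<star>\<^bsub>N\<^esub> Q"
    using range_inverse_invariant[OF _ C BCFB] F B by auto
  define G where "G = B \<star>\<^bsub>N\<^esub> (Q \<star>\<^bsub>N\<^esub> F)"
  \<comment> \<open>The projection \<open>B Y\<close> maps \<open>R(A)\<close> into \<open>R(A)\<close>; taking adjoints then gives commutation.\<close>
  have PBA: "B \<star>\<^bsub>N\<^esub> (Y \<star>\<^bsub>N\<^esub> A) = A \<star>\<^bsub>N\<^esub> G"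
    using YA Q unfolding G_def by (metis C_def einstein_prod_assoc)
  let ?P = "A \<star>\<^bsub>N\<^esub> X" and ?Q = "B \<star>\<^bsub>N\<^esub> Y"
  have "?P \<star>\<^bsub>N\<^esub> (?Q \<star>\<^bsub>N\<^esub> ?P) = ?Q \<star>\<^bsub>N\<^esub> ?P"
    using PBA core_inverse_inner[OF A X] by (metis einstein_prod_assoc)
  then show "?P \<star>\<^bsub>N\<^esub> ?Q = ?Q \<star>\<^bsub>N\<^esub> ?P"
    using X' Y' by (metis ctranspose_prod einstein_prod_assoc)
qed

text \<open>
  The core inverse \<open>Z\<close> of \<open>A B\<close> need only exist; it serves to cancel \<open>A B\<close> on \<open>R(A B)\<close> on the left.
\<close>
lemma reverse_order_law_sufficient:
  assumes A: "A \<in> tensors N" and B: "B \<in> tensors N"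
    and X: "is_core_inverse N A X" and Y: "is_core_inverse N B Y"
    and Z: "is_core_inverse N (A \<star>\<^bsub>N\<^esub> B) Z"
    and H: "ctranspose A \<star>\<^bsub>N\<^esub> B = (B \<star>\<^bsub>N\<^esub> ctranspose A) \<star>\<^bsub>N\<^esub> H"
    and K: "Y \<star>\<^bsub>N\<^esub> A = (A \<star>\<^bsub>N\<^esub> B) \<star>\<^bsub>N\<^esub> K"
    and G: "A \<star>\<^bsub>N\<^esub> B = (B \<star>\<^bsub>N\<^esub> A) \<star>\<^bsub>N\<^esub> G"
    and commute: "(A \<star>\<^bsub>N\<^esub> X) \<star>\<^bsub>N\<^esub> (B \<star>\<^bsub>N\<^esub> Y) = (B \<star>\<^bsub>N\<^esub> Y) \<star>\<^bsub>N\<^esub> (A \<star>\<^bsub>N\<^esub> X)"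
  shows "is_core_inverse N (A \<star>\<^bsub>N\<^esub> B) (Y \<star>\<^bsub>N\<^esub> X)"
proof -
  note X' = X[unfolded is_core_inverse_iff[OF A]] and Y' = Y[unfolded is_core_inverse_iff[OF B]]
  define C where "C = A \<star>\<^bsub>N\<^esub> B"
  have C: "C \<in> tensors N" using A B by (simp add: C_def)
  note Z' = Z[folded C_def, unfolded is_core_inverse_iff[OF C]]
  define P where "P = B \<star>\<^bsub>N\<^esub> Y"
  have PB: "P \<star>\<^bsub>N\<^esub> B = B" and P: "ctranspose P = P"
    using core_inverse_inner[OF B Y] Y' by (simp_all add: P_def einstein_prod_assoc)
  have PC: "P \<star>\<^bsub>N\<^esub> C = C"
    using PB G by (metis C_def einstein_prod_assoc)
  have BP: "ctranspose B \<star>\<^bsub>N\<^esub> P = ctranspose B"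
    using PB P by (metis ctranspose_prod)
  \<comment> \<open>By the adjoint of the equation for \<open>H\<close>, \<open>A\<close> leaves the orthogonal complement of \<open>R(B)\<close> invariant.\<close>
  have BA: "ctranspose B \<star>\<^bsub>N\<^esub> A = ctranspose H \<star>\<^bsub>N\<^esub> (A \<star>\<^bsub>N\<^esub> ctranspose B)"
    using arg_cong[OF H, of ctranspose] by (simp add: ctranspose_prod)
  have "ctranspose B \<star>\<^bsub>N\<^esub> (A \<star>\<^bsub>N\<^esub> P) = ctranspose B \<star>\<^bsub>N\<^esub> A"
    using BA BP by (metis einstein_prod_assoc)
  moreover have "P = ctranspose Y \<star>\<^bsub>N\<^esub> ctranspose B"
    using P by (simp add: P_def ctranspose_prod)
  ultimately have PAP: "P \<star>\<^bsub>N\<^esub> (A \<star>\<^bsub>N\<^esub> P) = P \<star>\<^bsub>N\<^esub> A"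
    by (metis einstein_prod_assoc)
  have AP: "A \<star>\<^bsub>N\<^esub> P = C \<star>\<^bsub>N\<^esub> Y"
    by (simp add: C_def P_def einstein_prod_assoc)
  have "P \<star>\<^bsub>N\<^esub> (A \<star>\<^bsub>N\<^esub> P) = A \<star>\<^bsub>N\<^esub> P"
    using AP PC by (metis einstein_prod_assoc)
  with PAP have PA: "A \<star>\<^bsub>N\<^esub> P = P \<star>\<^bsub>N\<^esub> A" by simp
  have proj: "C \<star>\<^bsub>N\<^esub> (Y \<star>\<^bsub>N\<^esub> X) = P \<star>\<^bsub>N\<^esub> (A \<star>\<^bsub>N\<^esub> X)"
    using AP PA by (metis einstein_prod_assoc)
  have herm: "ctranspose (C \<star>\<^bsub>N\<^esub> (Y \<star>\<^bsub>N\<^esub> X)) = C \<star>\<^bsub>N\<^esub> (Y \<star>\<^bsub>N\<^esub> X)"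
    using commute X' P unfolding proj P_def[symmetric] by (simp only: ctranspose_prod)
  have CYXC: "(C \<star>\<^bsub>N\<^esub> (Y \<star>\<^bsub>N\<^esub> X)) \<star>\<^bsub>N\<^esub> C = C"
    using proj PC core_inverse_inner[OF A X] by (metis C_def einstein_prod_assoc)
  have YX: "Y \<star>\<^bsub>N\<^esub> X = C \<star>\<^bsub>N\<^esub> (K \<star>\<^bsub>N\<^esub> (X \<star>\<^bsub>N\<^esub> X))"
    using K X' by (metis C_def einstein_prod_assoc)
  have outer: "C \<star>\<^bsub>N\<^esub> ((Y \<star>\<^bsub>N\<^esub> X) \<star>\<^bsub>N\<^esub> (Y \<star>\<^bsub>N\<^esub> X)) = Y \<star>\<^bsub>N\<^esub> X"
    using YX CYXC by (metis einstein_prod_assoc)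
  have "(Y \<star>\<^bsub>N\<^esub> X) \<star>\<^bsub>N\<^esub> (C \<star>\<^bsub>N\<^esub> C) = Z \<star>\<^bsub>N\<^esub> (C \<star>\<^bsub>N\<^esub> ((Y \<star>\<^bsub>N\<^esub> X) \<star>\<^bsub>N\<^esub> (C \<star>\<^bsub>N\<^esub> C)))"
    using YX Z' by (metis einstein_prod_assoc)
  also have "\<dots> = Z \<star>\<^bsub>N\<^esub> (C \<star>\<^bsub>N\<^esub> C)"
    using CYXC by (metis einstein_prod_assoc)
  also have "\<dots> = C" using Z' by blast
  finally have "(Y \<star>\<^bsub>N\<^esub> X) \<star>\<^bsub>N\<^esub> (C \<star>\<^bsub>N\<^esub> C) = C" .
  with herm outer X' Y' show ?thesis
    unfolding C_def[symmetric] is_core_inverse_iff[OF C] by simp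
qed

theorem theorem3p9:
  fixes N :: "nat list" and A B :: tensor
  assumes "A \<in> tensors N" and "B \<in> tensors N"
    and "core_tensor N A" and "core_tensor N B" and "core_tensor N (A \<star>\<^bsub>N\<^esub> B)"
    and "tensor_range N (ctranspose A \<star>\<^bsub>N\<^esub> B) = tensor_range N (B \<star>\<^bsub>N\<^esub> ctranspose A)"
  shows "core_inverse N (A \<star>\<^bsub>N\<^esub> B) = core_inverse N B \<star>\<^bsub>N\<^esub> core_inverse N A \<longleftrightarrow>
    (tensor_range N (core_inverse N B \<star>\<^bsub>N\<^esub> A) \<subseteq> tensor_range N (A \<star>\<^bsub>N\<^esub> B) \<and>
     tensor_range N (A \<star>\<^bsub>N\<^esub> B) \<subseteq> tensor_range N (B \<star>\<^bsub>N\<^esub> A)) \<and>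
    (A \<star>\<^bsub>N\<^esub> core_inverse N A) \<star>\<^bsub>N\<^esub> (B \<star>\<^bsub>N\<^esub> core_inverse N B) =
    (B \<star>\<^bsub>N\<^esub> core_inverse N B) \<star>\<^bsub>N\<^esub> (A \<star>\<^bsub>N\<^esub> core_inverse N A)"
proof -
  note A = assms(1) and B = assms(2)
  define X Y where "X = core_inverse N A" and "Y = core_inverse N B"
  have X: "is_core_inverse N A X" and Y: "is_core_inverse N B Y"
    using core_inverse_eq_iff assms(1-4) by (auto simp: X_def Y_def)
  have XY: "X \<in> tensors N" "Y \<in> tensors N"
    using X Y by (auto simp: is_core_inverse_def)
  have C: "is_core_inverse N (A \<star>\<^bsub>N\<^esub> B) (core_inverse N (A \<star>\<^bsub>N\<^esub> B))"
    using core_inverse_eq_iff[THEN iffD1, OF _ _ refl] A B assms(5) by simp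
  obtain H where H: "ctranspose A \<star>\<^bsub>N\<^esub> B = (B \<star>\<^bsub>N\<^esub> ctranspose A) \<star>\<^bsub>N\<^esub> H"
    using equalityD1[OF assms(6)] A B by (auto simp: tensor_range_subset_iff)
  have "core_inverse N (A \<star>\<^bsub>N\<^esub> B) = Y \<star>\<^bsub>N\<^esub> X \<longleftrightarrow> is_core_inverse N (A \<star>\<^bsub>N\<^esub> B) (Y \<star>\<^bsub>N\<^esub> X)"
    using core_inverse_eq_iff A B assms(5) by simp
  also have "\<dots> \<longleftrightarrow> ((\<exists>K\<in>tensors N. Y \<star>\<^bsub>N\<^esub> A = (A \<star>\<^bsub>N\<^esub> B) \<star>\<^bsub>N\<^esub> K) \<and>
      (\<exists>K\<in>tensors N. A \<star>\<^bsub>N\<^esub> B = (B \<star>\<^bsub>N\<^esub> A) \<star>\<^bsub>N\<^esub> K)) \<and>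
      (A \<star>\<^bsub>N\<^esub> X) \<star>\<^bsub>N\<^esub> (B \<star>\<^bsub>N\<^esub> Y) = (B \<star>\<^bsub>N\<^esub> Y) \<star>\<^bsub>N\<^esub> (A \<star>\<^bsub>N\<^esub> X)"
    using reverse_order_law_necessary[OF A B X Y] reverse_order_law_sufficient[OF A B X Y C H]
    by blast
  finally show ?thesis
    using A B XY unfolding X_def[symmetric] Y_def[symmetric] by (simp add: tensor_range_subset_iff)
qed

end
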